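(* Let $F,\|\cdot\|,\psi,q,\tau,L,\kappa,\mu$ satisfy the Assumption in the context (in particular $F$ is $(L,\kappa)$-weakly smooth with respect to $\|\cdot\|$). Let $C_t\ge0$, $\epsilon_t>0$ and $x_t,x_t^{ag}\in\mathbb{R}^d$ be fixed. Then Algorithm 2 (see context) terminates and finds $\lambda\in[0,1]$ such that, with $x_t^{md}=\lambda x_t^{ag}+(1-\lambda)x_t$, $$\langle\nabla F(x_t^{md}),x_t^{md}-x_t\rangle+C_t\big(F(x_t^{md})-F(x_t^{ag})\big)\le\epsilon_t,$$ and the number of iterations of its loop is at most $$c\left(\max\left\{0,\ \log(C_t),\ \log\Big(\frac{L\|x_t-x_t^{ag}\|^\kappa}{\epsilon_t}\Big)\right\}+1\right),$$ where $c>0$ is a constant depending only on $\kappa$ (and $\log 0=-\infty$).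
   Context: For a continuously differentiable $G:\mathbb{R}^d\to\mathbb{R}$ the Bregman divergence is $D_G(x,y):=G(x)-G(y)-\langle\nabla G(y),x-y\rangle$ (convexity of $G$ is not assumed). Assumption. $\|\cdot\|$ is an arbitrary norm on $\mathbb{R}^d$; $F,\psi:\mathbb{R}^d\to\mathbb{R}$ are continuously differentiable; $q\ge2$, $1<\kappa\le2$, $\tau,L,\mu>0$; and - $F$ is $\tau$-star-convex: there exists $x_\star\in\arg\min F$ such that $\tau\langle\nabla F(x),x-x_\star\rangle\ge F(x)-F(x_\star)$ for all $x\in\mathbb{R}^d$. - $F$ is $(L,\kappa)$-weakly smooth with respect to $\|\cdot\|$: $|D_F(x,y)|\le\frac{L}{\kappa}\|x-y\|^\kappa$ for all $x,y$. - $\psi$ is $(\mu,q)$-uniformly convex with respect to $\|\cdot\|$: $D_\psi(x,y)\ge\frac{\mu}{q}\|x-y\|^q$ for all $x,y$. Algorithm 2 (generalized binary search). Input: $F$, endpoints $x_t,x_t^{ag}$, parameters $C_t,\epsilon_t$. Let $g(\lambda)=F(\lambda x_t^{ag}+(1-\lambda)x_t)-F(x_t^{ag})$. If $g'(1)\le\epsilon_t$, return $\lambda=1$. Else if $C_tg(0)\le\epsilon_t$, return $\lambda=0$. Otherwise initialize $[a,b]=[0,1]$ and loop: set $\lambda=\frac{a+b}{2}$; if $\lambda g'(\lambda)+C_tg(\lambda)\le\epsilon_t$, return $\lambda$; else if $g(\lambda)>0$, replace $a$ by $\lambda$; else replace $b$ by $\lambda$. *)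

theory Defs
  imports "HOL-Analysis.Analysis"
begin

text \<open>
  The complexity constant must not depend on the dimension, so the dimension is a natural number
  and not a type: a point of $d$-dimensional real space is an element of
  \<^term>\<open>topspace (Euclidean_space d)\<close>, i.e. a function \<^typ>\<open>nat \<Rightarrow> real\<close> vanishing at all
  indices from \<open>d\<close> on. The values of \<open>F\<close>, \<open>\<psi>\<close> and of the norm outside this set play no role.
\<close>

type_synonym point = "nat \<Rightarrow> real"

abbreviation Rn :: "nat \<Rightarrow> point set"
  where "Rn d \<equiv> topspace (Euclidean_space d)"

abbreviation vsub :: "point \<Rightarrow> point \<Rightarrow> point"
  where "vsub x y \<equiv> (\<lambda>i. x i - y i)"

definition inner_n :: "nat \<Rightarrow> point \<Rightarrow> point \<Rightarrow> real"
  where "inner_n d x y = (\<Sum>i<d. x i * y i)"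

definition is_norm :: "nat \<Rightarrow> (point \<Rightarrow> real) \<Rightarrow> bool"
  where "is_norm d N \<longleftrightarrow>
    (\<forall>x\<in>Rn d. 0 \<le> N x \<and> (N x = 0 \<longleftrightarrow> x = (\<lambda>i. 0))) \<and>
    (\<forall>a. \<forall>x\<in>Rn d. N (\<lambda>i. a * x i) = \<bar>a\<bar> * N x) \<and>
    (\<forall>x\<in>Rn d. \<forall>y\<in>Rn d. N (\<lambda>i. x i + y i) \<le> N x + N y)"

definition grad :: "nat \<Rightarrow> (point \<Rightarrow> real) \<Rightarrow> point \<Rightarrow> point"
  where "grad d G x = (\<lambda>i. if i < d then deriv (\<lambda>t. G (x(i := t))) (x i) else 0)"

text \<open>
  \<open>G\<close> is (totally) differentiable at every point and its gradient is continuous. Differentiability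
  is what makes the vector of partial derivatives \<^const>\<open>grad\<close> meaningful: if \<open>G\<close> has some Frechet
  derivative at \<open>x\<close>, then that derivative is represented by \<open>grad d G x\<close>.
\<close>

definition continuously_differentiable :: "nat \<Rightarrow> (point \<Rightarrow> real) \<Rightarrow> bool"
  where "continuously_differentiable d G \<longleftrightarrow>
    (\<forall>x\<in>Rn d. ((\<lambda>y. (G y - G x - inner_n d (grad d G x) (vsub y x)) / L2_set (vsub y x) {..<d})
                  \<longlongrightarrow> 0) (atin (Euclidean_space d) x)) \<and>
    continuous_map (Euclidean_space d) (Euclidean_space d) (grad d G)"

definition bregman :: "nat \<Rightarrow> (point \<Rightarrow> real) \<Rightarrow> point \<Rightarrow> point \<Rightarrow> real"
  where "bregman d G x y = G x - G y - inner_n d (grad d G y) (vsub x y)"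

definition star_convex_fun :: "nat \<Rightarrow> real \<Rightarrow> (point \<Rightarrow> real) \<Rightarrow> bool"
  where "star_convex_fun d \<tau> F \<longleftrightarrow>
    (\<exists>xs. is_arg_min F (\<lambda>x. x \<in> Rn d) xs \<and>
      (\<forall>x\<in>Rn d. \<tau> * inner_n d (grad d F x) (vsub x xs) \<ge> F x - F xs))"

definition weakly_smooth :: "nat \<Rightarrow> (point \<Rightarrow> real) \<Rightarrow> real \<Rightarrow> real \<Rightarrow> (point \<Rightarrow> real) \<Rightarrow> bool"
  where "weakly_smooth d N L \<kappa> F \<longleftrightarrow>
    (\<forall>x\<in>Rn d. \<forall>y\<in>Rn d. \<bar>bregman d F x y\<bar> \<le> L / \<kappa> * N (vsub x y) powr \<kappa>)"

definition uniformly_convex :: "nat \<Rightarrow> (point \<Rightarrow> real) \<Rightarrow> real \<Rightarrow> real \<Rightarrow> (point \<Rightarrow> real) \<Rightarrow> bool"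
  where "uniformly_convex d N \<mu> q \<psi> \<longleftrightarrow>
    (\<forall>x\<in>Rn d. \<forall>y\<in>Rn d. bregman d \<psi> x y \<ge> \<mu> / q * N (vsub x y) powr q)"

definition segment_point :: "point \<Rightarrow> point \<Rightarrow> real \<Rightarrow> point"
  where "segment_point x xag l = (\<lambda>i. l * xag i + (1 - l) * x i)"

text \<open>
  The loop of the search, started on the interval \<open>[a, b]\<close> after \<open>k\<close> completed iterations. It
  returns the value found together with the total number of iterations (the one that returns is
  counted); the result \<^term>\<open>None\<close> means that the loop does not terminate.
\<close>

partial_function (option) search_loop ::
    "(real \<Rightarrow> real) \<Rightarrow> real \<Rightarrow> real \<Rightarrow> nat \<Rightarrow> real \<Rightarrow> real \<Rightarrow> (real \<times> nat) option"
  where "search_loop g C \<epsilon> k a b =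
    (let l = (a + b) / 2 in
     if l * deriv g l + C * g l \<le> \<epsilon> then Some (l, Suc k)
     else if g l > 0 then search_loop g C \<epsilon> (Suc k) l b
     else search_loop g C \<epsilon> (Suc k) a l)"

definition binary_search ::
    "(point \<Rightarrow> real) \<Rightarrow> point \<Rightarrow> point \<Rightarrow> real \<Rightarrow> real \<Rightarrow> (real \<times> nat) option"
  where "binary_search F x xag C \<epsilon> =
    (let g = (\<lambda>l. F (segment_point x xag l) - F xag) in
     if deriv g 1 \<le> \<epsilon> then Some (1, 0)
     else if C * g 0 \<le> \<epsilon> then Some (0, 0)
     else search_loop g C \<epsilon> 0 0 1)"

text \<open>
  The iteration bound involves $\max\{0, \log s, \log t\}$ with $\log 0 = -\infty$. In HOL
  \<^prop>\<open>ln (0::real) = 0\<close>; since \<open>0\<close> is already a member of the maximum, its value is the same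
  under both conventions.
\<close>

end

theory Submission
  imports Defs
begin

text \<open>
  Let \<open>g\<close> be the restriction of \<open>F - F xag\<close> to the segment. On that segment weak smoothness of \<open>F\<close>
  becomes \<open>\<bar>g u - g v - g' v * (u - v)\<bar> \<le> B * \<bar>u - v\<bar> powr \<kappa>\<close> with
  \<open>B = L / \<kappa> * N (x - xag) powr \<kappa>\<close>. As \<open>\<kappa> > 1\<close>, this makes \<open>g\<close> differentiable, and its derivative is the
  inner product of \<open>grad d F\<close> with \<open>xag - x\<close>.

  While the loop runs, its interval \<open>[a, b]\<close> satisfies \<open>g a > 0 \<ge> g b\<close> and \<open>g' b > \<epsilon>\<close>. The last
  inequality persists because a midpoint \<open>l\<close> that replaces \<open>b\<close> has failed the test although
  \<open>g l \<le> 0\<close>, so that \<open>l * g' l > \<epsilon>\<close> with \<open>l \<le> 1\<close>. But a function that falls from a positive to a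
  nonpositive value and arrives at \<open>b\<close> with a slope above \<open>\<epsilon>\<close> deviates at \<open>a\<close> by more than
  \<open>\<epsilon> * (b - a)\<close> from its tangent at \<open>b\<close>. Hence \<open>\<epsilon> < B * (b - a) powr (\<kappa> - 1)\<close>
  (lemma \<open>bracket_slope_bound\<close>), a lower bound on the length of every interval that occurs. Since
  each iteration halves the interval, the number of iterations is at most about
  \<open>max 0 (log 2 (B / \<epsilon>)) / (\<kappa> - 1)\<close>, which gives a constant depending only on \<open>\<kappa>\<close>.
\<close>

section \<open>Differentiability from a power error bound\<close>

text \<open>
  Dividing the hypothesis by \<open>\<bar>u - v\<bar>\<close> bounds the error of the difference quotient by a positive
  power of \<open>\<bar>u - v\<bar>\<close>, which tends to \<open>0\<close>.
\<close>

lemma DERIV_of_powr_error_bound: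
  fixes g :: "real \<Rightarrow> real"
  assumes "1 < \<kappa>"
    and bound: "\<And>u. \<bar>g u - g v - D * (u - v)\<bar> \<le> B * \<bar>u - v\<bar> powr \<kappa>"
  shows "(g has_real_derivative D) (at v)"
proof -
  have "((\<lambda>u. \<bar>u - v\<bar> powr (\<kappa> - 1)) \<longlongrightarrow> 0) (at v)"
  proof (rule tendsto_zero_powrI)
    have "((\<lambda>u. \<bar>u - v\<bar>) \<longlongrightarrow> \<bar>v - v\<bar>) (at v)"
      by (intro tendsto_intros)
    then show "((\<lambda>u. \<bar>u - v\<bar>) \<longlongrightarrow> 0) (at v)" by simp
  qed (use \<open>1 < \<kappa>\<close> in auto)
  from tendsto_mult_right_zero[OF this, of B]
  have lim: "((\<lambda>u. B * \<bar>u - v\<bar> powr (\<kappa> - 1)) \<longlongrightarrow> 0) (at v)" .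
  have "\<bar>(g u - g v) / (u - v) - D\<bar> \<le> B * \<bar>u - v\<bar> powr (\<kappa> - 1)" if "u \<noteq> v" for u
  proof -
    have "\<bar>(g u - g v) / (u - v) - D\<bar> = \<bar>g u - g v - D * (u - v)\<bar> / \<bar>u - v\<bar>"
      using that by (simp add: divide_simps flip: abs_divide)
    also have "\<dots> \<le> B * \<bar>u - v\<bar> powr \<kappa> / \<bar>u - v\<bar>"
      using bound by (intro divide_right_mono) auto
    also have "\<dots> = B * \<bar>u - v\<bar> powr (\<kappa> - 1)"
      using that by (simp add: powr_diff)
    finally show ?thesis .
  qed
  then have "\<forall>\<^sub>F u in at v. norm ((g u - g v) / (u - v) - D) \<le> B * \<bar>u - v\<bar> powr (\<kappa> - 1)"
    by (simp add: eventually_at_filter)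
  from Lim_null_comparison[OF this lim]
  have "((\<lambda>u. (g u - g v) / (u - v)) \<longlongrightarrow> D) (at v)"
    by (simp add: LIM_zero_iff)
  then show ?thesis by (simp add: has_field_derivative_iff)
qed

section \<open>Termination of the bisection\<close>

text \<open>
  The tangent at \<open>b\<close> lies below \<open>-\<epsilon> * (b - a)\<close> at \<open>a\<close>, whereas \<open>g a\<close> is positive: the error of the
  tangent at \<open>a\<close> exceeds \<open>\<epsilon> * (b - a)\<close>.
\<close>

lemma bracket_slope_bound:
  fixes g :: "real \<Rightarrow> real"
  assumes bound: "\<bar>g a - g b - D * (a - b)\<bar> \<le> B * \<bar>a - b\<bar> powr \<kappa>"
    and "a < b" "0 < g a" "g b \<le> 0" "\<epsilon> < D"
  shows "\<epsilon> < B * (b - a) powr (\<kappa> - 1)"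
proof -
  have "\<epsilon> * (b - a) < D * (b - a)"
    using assms by simp
  also have "\<dots> < g a - g b - D * (a - b)"
    using assms by (simp add: algebra_simps)
  also have "\<dots> \<le> B * (b - a) powr \<kappa>"
    using bound \<open>a < b\<close> by simp
  also have "\<dots> = B * (b - a) powr (\<kappa> - 1) * (b - a)"
    using \<open>a < b\<close> by (simp add: powr_diff)
  finally show ?thesis
    using \<open>a < b\<close> by simp
qed

text \<open>
  The induction is on a budget \<open>j\<close> of iterations after which an interval of length \<open>b - a\<close> would have
  become too short for \<open>bracket_slope_bound\<close>. With budget \<open>0\<close> the invariant is therefore
  contradictory, so the loop returns within the budget.
\<close>

lemma search_loop_terminates:
  fixes g :: "real \<Rightarrow> real"
  assumes bound: "\<And>u v. \<bar>g u - g v - deriv g v * (u - v)\<bar> \<le> B * \<bar>u - v\<bar> powr \<kappa>"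
    and "0 \<le> C" "0 < \<epsilon>"
    and "0 \<le> a" "a < b" "b \<le> 1" "0 < g a" "g b \<le> 0" "\<epsilon> < deriv g b"
    and "B * ((b - a) / 2 ^ j) powr (\<kappa> - 1) \<le> \<epsilon>"
  shows "\<exists>l n. search_loop g C \<epsilon> k a b = Some (l, n) \<and> a \<le> l \<and> l \<le> b \<and>
    l * deriv g l + C * g l \<le> \<epsilon> \<and> n \<le> k + j"
  using assms(4-)
proof (induction j arbitrary: k a b)
  case 0
  have "\<epsilon> < B * (b - a) powr (\<kappa> - 1)"
    using 0 by (intro bracket_slope_bound[OF bound[of a b]]) auto
  with 0 show ?case by simp
next
  case (Suc j)
  define l where "l = (a + b) / 2"
  have l: "a < l" "l < b"
    using Suc.prems by (auto simp: l_def)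
  have halves: "(b - l) / 2 ^ j = (b - a) / 2 ^ Suc j" "(l - a) / 2 ^ j = (b - a) / 2 ^ Suc j"
    by (auto simp: l_def field_simps)
  have step: "search_loop g C \<epsilon> k a b =
      (if l * deriv g l + C * g l \<le> \<epsilon> then Some (l, Suc k)
       else if g l > 0 then search_loop g C \<epsilon> (Suc k) l b
       else search_loop g C \<epsilon> (Suc k) a l)"
    by (subst search_loop.simps) (simp add: l_def Let_def)
  consider "l * deriv g l + C * g l \<le> \<epsilon>"
    | "\<epsilon> < l * deriv g l + C * g l" "0 < g l"
    | "\<epsilon> < l * deriv g l + C * g l" "g l \<le> 0"
    by linarith
  then show ?case
  proof cases
    case 1
    then show ?thesis using step l by auto
  next
    case 2
    have "\<exists>l' n. search_loop g C \<epsilon> (Suc k) l b = Some (l', n) \<and> l \<le> l' \<and> l' \<le> b \<and>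
        l' * deriv g l' + C * g l' \<le> \<epsilon> \<and> n \<le> Suc k + j"
      by (rule Suc.IH) (use Suc.prems 2 l halves in auto)
    then show ?thesis using step 2 l by fastforce
  next
    case 3
    have "C * g l \<le> 0"
      using \<open>0 \<le> C\<close> 3 by (simp add: mult_nonneg_nonpos)
    then have slope: "\<epsilon> < l * deriv g l"
      using 3 by simp
    have "0 < deriv g l"
      using order.strict_trans[OF \<open>0 < \<epsilon>\<close> slope] l(1) Suc.prems(1)
      by (simp add: zero_less_mult_iff)
    then have "l * deriv g l \<le> deriv g l"
      using l Suc.prems by simp
    then have "\<epsilon> < deriv g l"
      using slope by simp
    then have "\<exists>l' n. search_loop g C \<epsilon> (Suc k) a l = Some (l', n) \<and> a \<le> l' \<and> l' \<le> l \<and>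
        l' * deriv g l' + C * g l' \<le> \<epsilon> \<and> n \<le> Suc k + j"
      by (intro Suc.IH) (use Suc.prems 3 l halves in auto)
    then show ?thesis using step 3 l by fastforce
  qed
qed

text \<open>
  The budget is the least \<open>j\<close> with \<open>j * (\<kappa> - 1) * ln 2 \<ge> M\<close>; since \<open>M\<close> dominates \<open>ln (A / \<epsilon>)\<close>,
  exponentiating gives the first claim. Rounding up costs at most \<open>1\<close>, which the summand \<open>1\<close> in
  \<open>M + 1\<close> absorbs.
\<close>

lemma iteration_budget:
  fixes \<kappa> \<epsilon> A M :: real
  assumes "1 < \<kappa>" "0 < \<epsilon>" "0 \<le> A" "0 \<le> M" "ln (A / \<epsilon>) \<le> M"
  obtains j :: nat where "A * (1 / 2 ^ j) powr (\<kappa> - 1) \<le> \<epsilon>"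
    and "real j \<le> (1 + 1 / (ln 2 * (\<kappa> - 1))) * (M + 1)"
proof -
  define s where "s = ln 2 * (\<kappa> - 1)"
  have "0 < s"
    using \<open>1 < \<kappa>\<close> by (simp add: s_def)
  define j where "j = nat \<lceil>M / s\<rceil>"
  have j: "M / s \<le> real j" "real j \<le> M / s + 1"
    using \<open>0 \<le> M\<close> \<open>0 < s\<close> unfolding j_def by (simp_all add: real_nat_ceiling_ge of_int_ceiling_le_add_one)
  have "real j \<le> (1 + 1 / s) * (M + 1)"
  proof -
    have "(1 + 1 / s) * (M + 1) = M / s + 1 + (M + 1 / s)"
      using \<open>0 < s\<close> by (simp add: field_simps)
    moreover have "0 \<le> M + 1 / s" using \<open>0 \<le> M\<close> \<open>0 < s\<close> by simp
    ultimately show ?thesis using j by linarith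
  qed
  moreover have "A * (1 / 2 ^ j) powr (\<kappa> - 1) \<le> \<epsilon>"
    \<comment> \<open>For \<open>A = 0\<close>, where \<open>x = xag\<close> in the application, the hypothesis on \<open>ln (A / \<epsilon>)\<close> carries no
      information because \<open>ln 0 = 0\<close>.\<close>
  proof (cases "A = 0")
    case False
    then have "0 < A / \<epsilon>" using assms by simp
    then have "A / \<epsilon> \<le> exp M"
      using \<open>ln (A / \<epsilon>) \<le> M\<close> by (metis exp_le_cancel_iff exp_ln)
    also have "\<dots> \<le> exp (real j * s)"
      using j \<open>0 < s\<close> by (simp add: field_simps)
    finally have "A \<le> \<epsilon> * exp (real j * s)"
      using \<open>0 < \<epsilon>\<close> by (simp add: field_simps)
    moreover have "(1 / 2 ^ j) powr (\<kappa> - 1) = exp (- (real j * s))"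
      by (simp add: powr_def ln_div ln_realpow s_def)
    ultimately show ?thesis by (simp add: exp_minus pos_divide_le_eq flip: divide_inverse)
  qed (use \<open>0 < \<epsilon>\<close> in simp)
  ultimately show ?thesis
    using that by (simp add: s_def)
qed

section \<open>Restriction to a segment\<close>

lemma segment_point_in_Rn:
  assumes "x \<in> Rn d" "xag \<in> Rn d"
  shows "segment_point x xag l \<in> Rn d"
  using assms by (simp add: topspace_Euclidean_space segment_point_def)

lemma vsub_segment_point:
  "vsub (segment_point x xag u) (segment_point x xag v) = (\<lambda>i. (u - v) * vsub xag x i)"
  by (auto simp: segment_point_def algebra_simps)

lemma segment_point_0 [simp]: "segment_point x xag 0 = x"
  and segment_point_1 [simp]: "segment_point x xag 1 = xag"
  by (simp_all add: segment_point_def)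

lemma inner_n_scale_right: "inner_n d x (\<lambda>i. a * y i) = a * inner_n d x y"
  by (simp add: inner_n_def sum_distrib_left mult.left_commute)

text \<open>
  The difference of the segment points at \<open>u\<close> and \<open>v\<close> is \<open>v - u\<close> times \<open>x - xag\<close>, so homogeneity of
  the norm turns the bound on the Bregman divergence into a bound in \<open>\<bar>u - v\<bar>\<close>.
\<close>

lemma weakly_smooth_on_segment:
  assumes "is_norm d N" "weakly_smooth d N L \<kappa> F" "x \<in> Rn d" "xag \<in> Rn d"
  shows "\<bar>F (segment_point x xag u) - F (segment_point x xag v)
      - inner_n d (grad d F (segment_point x xag v)) (vsub xag x) * (u - v)\<bar>
    \<le> L / \<kappa> * N (vsub x xag) powr \<kappa> * \<bar>u - v\<bar> powr \<kappa>"
proof -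
  let ?p = "segment_point x xag"
  have "vsub x xag \<in> Rn d"
    using assms by (simp add: topspace_Euclidean_space)
  moreover have "N (\<lambda>i. a * y i) = \<bar>a\<bar> * N y" "0 \<le> N y" if "y \<in> Rn d" for a y
    using \<open>is_norm d N\<close> that by (simp_all add: is_norm_def)
  ultimately have scale: "N (\<lambda>i. (v - u) * vsub x xag i) = \<bar>v - u\<bar> * N (vsub x xag)"
    and nonneg: "0 \<le> N (vsub x xag)"
    by blast+
  have "vsub (?p u) (?p v) = (\<lambda>i. (v - u) * vsub x xag i)"
    unfolding vsub_segment_point by (auto simp: algebra_simps)
  with scale have "N (vsub (?p u) (?p v)) = \<bar>u - v\<bar> * N (vsub x xag)"
    by (simp add: abs_minus_commute)
  moreover have "\<bar>bregman d F (?p u) (?p v)\<bar> \<le> L / \<kappa> * N (vsub (?p u) (?p v)) powr \<kappa>"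
    using assms segment_point_in_Rn unfolding weakly_smooth_def by blast
  ultimately have "\<bar>bregman d F (?p u) (?p v)\<bar> \<le> L / \<kappa> * N (vsub x xag) powr \<kappa> * \<bar>u - v\<bar> powr \<kappa>"
    using nonneg by (simp add: powr_mult mult_ac)
  then show ?thesis
    by (simp only: bregman_def vsub_segment_point inner_n_scale_right mult.commute)
qed

lemma binary_search_terminates:
  fixes F :: "point \<Rightarrow> real"
  assumes norm: "is_norm d N" and smooth: "weakly_smooth d N L \<kappa> F"
    and Rn: "x \<in> Rn d" "xag \<in> Rn d"
    and "1 < \<kappa>" "0 \<le> C" "0 < \<epsilon>"
    and budget: "L / \<kappa> * N (vsub x xag) powr \<kappa> * (1 / 2 ^ j) powr (\<kappa> - 1) \<le> \<epsilon>"
  shows "\<exists>l n. binary_search F x xag C \<epsilon> = Some (l, n) \<and> 0 \<le> l \<and> l \<le> 1 \<and>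
    inner_n d (grad d F (segment_point x xag l)) (vsub (segment_point x xag l) x)
      + C * (F (segment_point x xag l) - F xag) \<le> \<epsilon> \<and> n \<le> j"
proof -
  define g where "g = (\<lambda>l. F (segment_point x xag l) - F xag)"
  define D where "D = (\<lambda>l. inner_n d (grad d F (segment_point x xag l)) (vsub xag x))"
  define B where "B = L / \<kappa> * N (vsub x xag) powr \<kappa>"
  have bound: "\<bar>g u - g v - D v * (u - v)\<bar> \<le> B * \<bar>u - v\<bar> powr \<kappa>" for u v
    using weakly_smooth_on_segment[OF norm smooth Rn, of u v] by (simp add: g_def D_def B_def)
  have deriv: "deriv g l = D l" for l
    using DERIV_of_powr_error_bound[OF \<open>1 < \<kappa>\<close> bound] by (rule DERIV_imp_deriv)
  \<comment> \<open>The test inside the loop is the target inequality, because \<open>xmd - x = l * (xag - x)\<close>.\<close>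
  have test: "inner_n d (grad d F (segment_point x xag l)) (vsub (segment_point x xag l) x)
      + C * (F (segment_point x xag l) - F xag) = l * deriv g l + C * g l" for l
    using vsub_segment_point[of x xag l 0]
    by (simp add: inner_n_scale_right deriv) (simp add: D_def g_def)
  have "\<exists>l n. binary_search F x xag C \<epsilon> = Some (l, n) \<and> 0 \<le> l \<and> l \<le> 1 \<and>
    l * deriv g l + C * g l \<le> \<epsilon> \<and> n \<le> j"
  proof -
    have search: "binary_search F x xag C \<epsilon> =
        (if deriv g 1 \<le> \<epsilon> then Some (1, 0) else if C * g 0 \<le> \<epsilon> then Some (0, 0)
         else search_loop g C \<epsilon> 0 0 1)"
      by (simp add: binary_search_def g_def Let_def)
    have "g 1 = 0"
      by (simp add: g_def)
    consider "deriv g 1 \<le> \<epsilon>" | "\<epsilon> < deriv g 1" "C * g 0 \<le> \<epsilon>" | "\<epsilon> < deriv g 1" "\<epsilon> < C * g 0"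
      by linarith
    then show ?thesis
    proof cases
      case 1
      then show ?thesis using search \<open>g 1 = 0\<close> by auto
    next
      case 2
      then show ?thesis using search by auto
    next
      case 3
      have "0 < g 0"
        using 3 \<open>0 < \<epsilon>\<close> \<open>0 \<le> C\<close> by (smt (verit) mult_nonneg_nonpos)
      have "\<exists>l n. search_loop g C \<epsilon> 0 0 1 = Some (l, n) \<and> 0 \<le> l \<and> l \<le> 1 \<and>
          l * deriv g l + C * g l \<le> \<epsilon> \<and> n \<le> 0 + j"
        by (rule search_loop_terminates[where B = B and \<kappa> = \<kappa>])
          (use bound deriv 3 \<open>0 < g 0\<close> \<open>g 1 = 0\<close> \<open>0 \<le> C\<close> \<open>0 < \<epsilon>\<close> budget in \<open>auto simp: B_def\<close>)
      then show ?thesis using search 3 by auto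
    qed
  qed
  then show ?thesis by (simp add: test)
qed

theorem theorem4p1:
  fixes \<kappa> :: real
  assumes "1 < \<kappa>" and "\<kappa> \<le> 2"
  shows "\<exists>c>0. \<forall>(d::nat) (N :: point \<Rightarrow> real) (F :: point \<Rightarrow> real) (\<psi> :: point \<Rightarrow> real)
      (q::real) (\<tau>::real) (L::real) (\<mu>::real) (C::real) (\<epsilon>::real) (x::point) (xag::point).
    is_norm d N \<and>
    continuously_differentiable d F \<and> continuously_differentiable d \<psi> \<and>
    2 \<le> q \<and> 0 < \<tau> \<and> 0 < L \<and> 0 < \<mu> \<and>
    star_convex_fun d \<tau> F \<and> weakly_smooth d N L \<kappa> F \<and> uniformly_convex d N \<mu> q \<psi> \<and>
    0 \<le> C \<and> 0 < \<epsilon> \<and> x \<in> Rn d \<and> xag \<in> Rn d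
    \<longrightarrow>
    (\<exists>l n. binary_search F x xag C \<epsilon> = Some (l, n) \<and>
      0 \<le> l \<and> l \<le> 1 \<and>
      (let xmd = segment_point x xag l in
        inner_n d (grad d F xmd) (vsub xmd x) + C * (F xmd - F xag) \<le> \<epsilon>) \<and>
      real n \<le> c * (Max {0, ln C, ln (L * N (vsub x xag) powr \<kappa> / \<epsilon>)} + 1))"
proof (rule exI[of _ "1 + 1 / (ln 2 * (\<kappa> - 1))"], intro conjI allI impI)
  let ?c = "1 + 1 / (ln 2 * (\<kappa> - 1))"
  show "0 < ?c"
    using \<open>1 < \<kappa>\<close> by (simp add: add_pos_pos)
  fix d and N F \<psi> :: "point \<Rightarrow> real" and q \<tau> L \<mu> C \<epsilon> :: real and x xag :: point
  assume asm: "is_norm d N \<and>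
    continuously_differentiable d F \<and> continuously_differentiable d \<psi> \<and>
    2 \<le> q \<and> 0 < \<tau> \<and> 0 < L \<and> 0 < \<mu> \<and>
    star_convex_fun d \<tau> F \<and> weakly_smooth d N L \<kappa> F \<and> uniformly_convex d N \<mu> q \<psi> \<and>
    0 \<le> C \<and> 0 < \<epsilon> \<and> x \<in> Rn d \<and> xag \<in> Rn d"
  let ?A = "L * N (vsub x xag) powr \<kappa>"
  let ?M = "Max {0, ln C, ln (?A / \<epsilon>)}"
  have "0 \<le> ?A" "0 \<le> ?M" "ln (?A / \<epsilon>) \<le> ?M" "0 < \<epsilon>"
    using asm by auto
  then obtain j where j: "?A * (1 / 2 ^ j) powr (\<kappa> - 1) \<le> \<epsilon>" "real j \<le> ?c * (?M + 1)"
    using iteration_budget[OF \<open>1 < \<kappa>\<close>] by blast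
  have "L / \<kappa> * N (vsub x xag) powr \<kappa> * (1 / 2 ^ j) powr (\<kappa> - 1)
      = ?A * (1 / 2 ^ j) powr (\<kappa> - 1) / \<kappa>"
    by simp
  \<comment> \<open>The factor \<open>1 / \<kappa>\<close> is given away, so that \<open>ln (?A / \<epsilon>)\<close> can be compared with \<open>?M\<close>.\<close>
  also have "\<dots> \<le> ?A * (1 / 2 ^ j) powr (\<kappa> - 1) / 1"
    using \<open>1 < \<kappa>\<close> \<open>0 \<le> ?A\<close> by (intro divide_left_mono) auto
  also have "\<dots> \<le> \<epsilon>"
    using j by simp
  finally have "L / \<kappa> * N (vsub x xag) powr \<kappa> * (1 / 2 ^ j) powr (\<kappa> - 1) \<le> \<epsilon>" .
  then obtain l n where ln: "binary_search F x xag C \<epsilon> = Some (l, n)" "0 \<le> l" "l \<le> 1"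
      "inner_n d (grad d F (segment_point x xag l)) (vsub (segment_point x xag l) x)
        + C * (F (segment_point x xag l) - F xag) \<le> \<epsilon>" "n \<le> j"
    using binary_search_terminates[of d N L \<kappa> F x xag C \<epsilon> j] asm \<open>1 < \<kappa>\<close> by blast
  have "real n \<le> ?c * (?M + 1)"
    using j(2) \<open>n \<le> j\<close> by linarith
  with ln show "\<exists>l n. binary_search F x xag C \<epsilon> = Some (l, n) \<and>
      0 \<le> l \<and> l \<le> 1 \<and>
      (let xmd = segment_point x xag l in
        inner_n d (grad d F xmd) (vsub xmd x) + C * (F xmd - F xag) \<le> \<epsilon>) \<and>
      real n \<le> ?c * (?M + 1)"
    unfolding Let_def by blast
qed

end
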